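(* Let $\mathcal{M}$ be a neighborhood model, and let $ue(\mathcal{M})$ be its ultrafilter extension for contingency logic. Then $ue(\mathcal{M})$ is $\Delta$-saturated.
   Context: A neighborhood model is $\mathcal{M}=\langle S,N,V\rangle$ with $S\neq\emptyset$, $N:S\to\mathcal{P}(\mathcal{P}(S))$, $V:\mathbf{P}\to\mathcal{P}(S)$, where $\mathbf{P}$ is the set of propositional variables. $\mathcal{L}(\nabla)$ is the propositional language with $\neg,\wedge$ and a unary operator $\nabla$; $\Delta\phi$ abbreviates $\neg\nabla\phi$. Semantics: $\mathcal{M},s\Vdash\Delta\phi$ iff $V(\phi)\in N(s)$ or $\overline{V(\phi)}\in N(s)$, where $V(\phi)=\{w\in S\mid\mathcal{M},w\Vdash\phi\}$ and $\overline{X}$ denotes complement; Booleans as usual. For $X\subseteq S$, $m_C(X)=\{s\in S\mid X\in N(s)\text{ or }\overline{X}\in N(s)\}$. The ultrafilter extension is $ue(\mathcal{M})=\langle Uf(S),N^{ue},V^{ue}\rangle$, where $Uf(S)$ is the set of all ultrafilters over $S$; $N^{ue}(s)=\{\widehat{X}\mid X\subseteq S,\ m_C(X)\in s\}$ with $\widehat{X}=\{s\in Uf(S)\mid X\in s\}$; and $s\in V^{ue}(p)$ iff $V(p)\in s$. $\Delta$-saturation: let $\mathcal{N}=\langle S,N,V\rangle$ be a neighborhood model. A set $X\subseteq S$ is $\Delta$-compact if every set of $\mathcal{L}(\nabla)$-formulas that is finitely satisfiable in $X$ (each finite subset is jointly satisfied at some element of $X$) is itself satisfiable in $X$ (jointly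 satisfied at some element of $X$). $X$ is $\equiv_{\mathcal{L}(\nabla)}$-closed if whenever $x\in X$ and $y\in S$ satisfies exactly the same $\mathcal{L}(\nabla)$-formulas as $x$ in $\mathcal{N}$, then $y\in X$. $\mathcal{N}$ is $\Delta$-saturated if for all $s\in S$ and all $\equiv_{\mathcal{L}(\nabla)}$-closed neighborhoods $X\in N(s)$, both $X$ and $\overline{X}$ are $\Delta$-compact. *)

theory Defs
  imports Main
begin

section \<open>Neighborhood models and contingency logic\<close>

record ('w, 'p) nbhd_structure =
  worlds :: "'w set"
  nbhds :: "'w \<Rightarrow> 'w set set"
  val :: "'p \<Rightarrow> 'w set"

definition nbhd_model :: "('w, 'p) nbhd_structure \<Rightarrow> bool" where
  "nbhd_model M \<longleftrightarrow>
     worlds M \<noteq> {} \<and>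
     (\<forall>s \<in> worlds M. nbhds M s \<subseteq> Pow (worlds M)) \<and>
     (\<forall>p. val M p \<subseteq> worlds M)"

datatype 'p fm = Var 'p | Neg "'p fm" | Conj "'p fm" "'p fm" | Nabla "'p fm"

abbreviation Delta :: "'p fm \<Rightarrow> 'p fm" where
  "Delta \<phi> \<equiv> Neg (Nabla \<phi>)"

primrec sat :: "('w, 'p) nbhd_structure \<Rightarrow> 'w \<Rightarrow> 'p fm \<Rightarrow> bool" where
  "sat M s (Var p) \<longleftrightarrow> s \<in> val M p"
| "sat M s (Neg \<phi>) \<longleftrightarrow> \<not> sat M s \<phi>"
| "sat M s (Conj \<phi> \<psi>) \<longleftrightarrow> sat M s \<phi> \<and> sat M s \<psi>"
| "sat M s (Nabla \<phi>) \<longleftrightarrow>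
     \<not> ({w \<in> worlds M. sat M w \<phi>} \<in> nbhds M s \<or>
        worlds M - {w \<in> worlds M. sat M w \<phi>} \<in> nbhds M s)"

definition truth_set :: "('w, 'p) nbhd_structure \<Rightarrow> 'p fm \<Rightarrow> 'w set" where
  "truth_set M \<phi> = {w \<in> worlds M. sat M w \<phi>}"

lemma sat_Delta:
  "sat M s (Delta \<phi>) \<longleftrightarrow>
     truth_set M \<phi> \<in> nbhds M s \<or> worlds M - truth_set M \<phi> \<in> nbhds M s"
  by (simp add: truth_set_def)

section \<open>Saturation\<close>

definition satisfiable_in :: "('w, 'p) nbhd_structure \<Rightarrow> 'w set \<Rightarrow> 'p fm set \<Rightarrow> bool" where
  "satisfiable_in M X \<Gamma> \<longleftrightarrow> (\<exists>x \<in> X. \<forall>\<phi> \<in> \<Gamma>. sat M x \<phi>)"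

text \<open>The empty subset counts as a finite subset, so no set of formulas is finitely
  satisfiable in the empty set of worlds; the empty set is therefore compact.\<close>

definition finitely_satisfiable_in ::
    "('w, 'p) nbhd_structure \<Rightarrow> 'w set \<Rightarrow> 'p fm set \<Rightarrow> bool" where
  "finitely_satisfiable_in M X \<Gamma> \<longleftrightarrow>
     (\<forall>\<Gamma>\<^sub>0. finite \<Gamma>\<^sub>0 \<and> \<Gamma>\<^sub>0 \<subseteq> \<Gamma> \<longrightarrow> satisfiable_in M X \<Gamma>\<^sub>0)"

definition delta_compact :: "('w, 'p) nbhd_structure \<Rightarrow> 'w set \<Rightarrow> bool" where
  "delta_compact M X \<longleftrightarrow>
     (\<forall>\<Gamma>. finitely_satisfiable_in M X \<Gamma> \<longrightarrow> satisfiable_in M X \<Gamma>)"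

definition equiv_closed :: "('w, 'p) nbhd_structure \<Rightarrow> 'w set \<Rightarrow> bool" where
  "equiv_closed M X \<longleftrightarrow>
     (\<forall>x \<in> X. \<forall>y \<in> worlds M. (\<forall>\<phi>. sat M x \<phi> \<longleftrightarrow> sat M y \<phi>) \<longrightarrow> y \<in> X)"

definition delta_saturated :: "('w, 'p) nbhd_structure \<Rightarrow> bool" where
  "delta_saturated M \<longleftrightarrow>
     (\<forall>s \<in> worlds M. \<forall>X \<in> nbhds M s.
        equiv_closed M X \<longrightarrow> delta_compact M X \<and> delta_compact M (worlds M - X))"

section \<open>Ultrafilter extension\<close>

definition ultrafilters_over :: "'w set \<Rightarrow> 'w set set set" where
  "ultrafilters_over S =
     {u. u \<subseteq> Pow S \<and> S \<in> u \<and> {} \<notin> u \<and>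
         (\<forall>X \<in> u. \<forall>Y \<in> u. X \<inter> Y \<in> u) \<and>
         (\<forall>X \<in> u. \<forall>Y. X \<subseteq> Y \<and> Y \<subseteq> S \<longrightarrow> Y \<in> u) \<and>
         (\<forall>X. X \<subseteq> S \<longrightarrow> X \<in> u \<or> S - X \<in> u)}"

definition m_C :: "('w, 'p) nbhd_structure \<Rightarrow> 'w set \<Rightarrow> 'w set" where
  "m_C M X = {s \<in> worlds M. X \<in> nbhds M s \<or> worlds M - X \<in> nbhds M s}"

definition hat :: "'w set \<Rightarrow> 'w set \<Rightarrow> 'w set set set" where
  "hat S X = {u \<in> ultrafilters_over S. X \<in> u}"

definition ue :: "('w, 'p) nbhd_structure \<Rightarrow> ('w set set, 'p) nbhd_structure" where
  "ue M =
     \<lparr> worlds = ultrafilters_over (worlds M),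
       nbhds = (\<lambda>u. {hat (worlds M) X | X. X \<subseteq> worlds M \<and> m_C M X \<in> u}),
       val = (\<lambda>p. {u \<in> ultrafilters_over (worlds M). val M p \<in> u}) \<rparr>"

lemma principal_ultrafilter:
  assumes "s \<in> S"
  shows "{X. X \<subseteq> S \<and> s \<in> X} \<in> ultrafilters_over S"
  using assms unfolding ultrafilters_over_def by auto

lemma nbhd_model_ue:
  assumes "nbhd_model M"
  shows "nbhd_model (ue M)"
proof -
  obtain s where "s \<in> worlds M"
    using assms unfolding nbhd_model_def by blast
  then have "ultrafilters_over (worlds M) \<noteq> {}"
    using principal_ultrafilter[of s "worlds M"] by (metis empty_iff)
  then show ?thesis
    unfolding nbhd_model_def ue_def
    by (simp add: hat_def subset_iff) (auto simp: hat_def)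
qed

end

theory Submission
  imports Defs
begin

text \<open>
  The map \<open>hat\<close> embeds the powerset algebra of \<open>worlds M\<close> into that of the ultrafilters.
  It commutes with the Booleans, and the definition of the neighborhoods of \<open>ue M\<close> makes it commute
  with the modality as well, because \<open>hat\<close> is injective: the neighborhood \<open>hat X\<close> determines \<open>X\<close>,
  so nothing but \<open>X\<close> itself can witness that \<open>hat X\<close> is a neighborhood.  Hence the truth set of
  a formula in \<open>ue M\<close> is the \<open>hat\<close> of its truth set in \<open>M\<close> (lemma \<open>truth_set_ue\<close>).

  Every neighborhood in \<open>ue M\<close> is some \<open>hat X\<close>, and its complement is the \<open>hat\<close> of the complement
  of \<open>X\<close>.  So saturation reduces to the compactness of each \<open>hat X\<close>, that is, of each basic clopen set
  of the Stone space (lemma \<open>delta_compact_hat\<close>): if \<open>\<Gamma>\<close> is finitely satisfiable in \<open>hat X\<close>, then the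
  truth sets in \<open>M\<close> of the members of \<open>\<Gamma>\<close> have, together with \<open>X\<close>, the finite intersection property,
  and an ultrafilter containing all of them is a point of \<open>hat X\<close> that satisfies \<open>\<Gamma>\<close>.
\<close>

section \<open>The ultrafilter theorem\<close>

text \<open>Intersecting with \<open>S\<close> gives the empty intersection its value relative to \<open>S\<close>; in particular
  the empty family has the property exactly when \<open>S\<close> is nonempty.\<close>

definition fip :: "'w set \<Rightarrow> 'w set set \<Rightarrow> bool" where
  "fip S F \<longleftrightarrow> (\<forall>G. finite G \<and> G \<subseteq> F \<longrightarrow> S \<inter> \<Inter>G \<noteq> {})"

lemma fipD: "fip S F \<Longrightarrow> finite G \<Longrightarrow> G \<subseteq> F \<Longrightarrow> S \<inter> \<Inter>G \<noteq> {}"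
  unfolding fip_def by blast

lemma fip_insert_iff:
  "fip S (insert Y F) \<longleftrightarrow> (\<forall>G. finite G \<and> G \<subseteq> F \<longrightarrow> S \<inter> \<Inter>G \<inter> Y \<noteq> {})"
proof
  assume fip: "fip S (insert Y F)"
  show "\<forall>G. finite G \<and> G \<subseteq> F \<longrightarrow> S \<inter> \<Inter>G \<inter> Y \<noteq> {}"
  proof (intro allI impI)
    fix G assume "finite G \<and> G \<subseteq> F"
    then have "S \<inter> \<Inter>(insert Y G) \<noteq> {}"
      by (intro fipD[OF fip]) auto
    then show "S \<inter> \<Inter>G \<inter> Y \<noteq> {}" by auto
  qed
next
  assume meets: "\<forall>G. finite G \<and> G \<subseteq> F \<longrightarrow> S \<inter> \<Inter>G \<inter> Y \<noteq> {}"
  show "fip S (insert Y F)"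
    unfolding fip_def
  proof (intro allI impI)
    fix G assume "finite G \<and> G \<subseteq> insert Y F"
    then have "S \<inter> \<Inter>(G - {Y}) \<inter> Y \<noteq> {}"
      by (intro meets[rule_format]) auto
    then show "S \<inter> \<Inter>G \<noteq> {}" by blast
  qed
qed

text \<open>Maximality says that a subset of \<open>S\<close> that meets all finite intersections already belongs
  to \<open>U\<close>.  If \<open>X\<close> is not in \<open>U\<close>, then some finite intersection misses \<open>X\<close>, so it is contained in
  \<open>S - X\<close>, which is therefore in \<open>U\<close>.\<close>

lemma maximal_fip_is_ultrafilter:
  assumes sub: "U \<subseteq> Pow S" and fip: "fip S U"
    and maximal: "\<And>Y. Y \<subseteq> S \<Longrightarrow> fip S (insert Y U) \<Longrightarrow> Y \<in> U"
  shows "U \<in> ultrafilters_over S"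
proof -
  have above: "Y \<in> U" if "finite G" "G \<subseteq> U" "S \<inter> \<Inter>G \<subseteq> Y" "Y \<subseteq> S" for G Y
  proof (rule maximal[OF \<open>Y \<subseteq> S\<close>], unfold fip_insert_iff, intro allI impI)
    fix H assume "finite H \<and> H \<subseteq> U"
    then have "S \<inter> \<Inter>(G \<union> H) \<noteq> {}"
      using that by (intro fipD[OF fip]) auto
    then show "S \<inter> \<Inter>H \<inter> Y \<noteq> {}" using \<open>S \<inter> \<Inter>G \<subseteq> Y\<close> by blast
  qed
  have "S \<in> U"
    by (rule above[of "{}"]) auto
  moreover have "{} \<notin> U"
    using fipD[OF fip, of "{{}}"] by auto
  moreover have "X \<inter> Y \<in> U" if "X \<in> U" "Y \<in> U" for X Y
    using that sub by (intro above[of "{X, Y}"]) auto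
  moreover have "Y \<in> U" if "X \<in> U" "X \<subseteq> Y" "Y \<subseteq> S" for X Y
    using that by (intro above[of "{X}"]) auto
  moreover have "S - X \<in> U \<or> X \<in> U" if "X \<subseteq> S" for X
  proof (rule disjCI)
    assume "X \<notin> U"
    then obtain G where "finite G" "G \<subseteq> U" "S \<inter> \<Inter>G \<inter> X = {}"
      using maximal[OF \<open>X \<subseteq> S\<close>] unfolding fip_insert_iff by blast
    then show "S - X \<in> U" by (intro above[of G]) auto
  qed
  ultimately show ?thesis
    using sub unfolding ultrafilters_over_def by (intro CollectI conjI) metis+
qed

text \<open>Zorn's lemma provides a maximal extension, since the finite intersection property is of
  finite character and so passes to unions of chains.\<close>

lemma ultrafilter_extending_fip:
  assumes "F \<subseteq> Pow S" and "fip S F"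
  obtains u where "u \<in> ultrafilters_over S" and "F \<subseteq> u"
proof -
  define A where "A = {U. F \<subseteq> U \<and> U \<subseteq> Pow S \<and> fip S U}"
  have "F \<in> A" using assms by (simp add: A_def)
  have "\<exists>U\<in>A. \<forall>X\<in>A. U \<subseteq> X \<longrightarrow> X = U"
  proof (rule subset_Zorn_nonempty)
    show "A \<noteq> {}" using \<open>F \<in> A\<close> by blast
  next
    fix \<C> assume "\<C> \<noteq> {}" and chain: "subset.chain A \<C>"
    then have "\<C> \<subseteq> A" by (simp add: subset_chain_def)
    have "fip S (\<Union>\<C>)"
      unfolding fip_def
    proof (intro allI impI)
      fix G assume "finite G \<and> G \<subseteq> \<Union>\<C>"
      then obtain U where "U \<in> \<C>" "G \<subseteq> U"
        using finite_subset_Union_chain[OF _ _ \<open>\<C> \<noteq> {}\<close> chain] by metis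
      moreover from this have "fip S U"
        using \<open>\<C> \<subseteq> A\<close> by (auto simp: A_def)
      ultimately show "S \<inter> \<Inter>G \<noteq> {}"
        using \<open>finite G \<and> _\<close> fipD by blast
    qed
    then show "\<Union>\<C> \<in> A"
      using \<open>\<C> \<noteq> {}\<close> \<open>\<C> \<subseteq> A\<close> unfolding A_def by blast
  qed
  then obtain U where "U \<in> A" and max: "\<And>X. X \<in> A \<Longrightarrow> U \<subseteq> X \<Longrightarrow> X = U" by blast
  then have "U \<in> ultrafilters_over S"
  proof (intro maximal_fip_is_ultrafilter)
    fix Y assume "Y \<subseteq> S" "fip S (insert Y U)"
    then have "insert Y U \<in> A" using \<open>U \<in> A\<close> by (auto simp: A_def)
    then show "Y \<in> U" using max by blast
  qed (auto simp: A_def)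
  then show thesis using that \<open>U \<in> A\<close> by (simp add: A_def)
qed

lemma ultrafilter_fip:
  assumes "u \<in> ultrafilters_over S"
  shows "fip S u"
  unfolding fip_def
proof (intro allI impI)
  fix G assume "finite G \<and> G \<subseteq> u"
  then have "finite G" "G \<subseteq> u" by auto
  then have "S \<inter> \<Inter>G \<in> u"
  proof (induction G rule: finite_induct)
    case empty
    then show ?case using assms by (simp add: ultrafilters_over_def)
  next
    case (insert Y G)
    then have "Y \<inter> (S \<inter> \<Inter>G) \<in> u"
      using assms by (simp add: ultrafilters_over_def)
    then show ?case by (simp add: Int_left_commute)
  qed
  then show "S \<inter> \<Inter>G \<noteq> {}"
    using assms by (auto simp: ultrafilters_over_def)
qed

section \<open>The Stone embedding and the truth lemma\<close>

lemma ultrafilter_Diff_iff: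
  assumes "u \<in> ultrafilters_over S" and "X \<subseteq> S"
  shows "S - X \<in> u \<longleftrightarrow> X \<notin> u"
proof -
  have "X \<in> u \<or> S - X \<in> u"
    using assms by (simp add: ultrafilters_over_def)
  moreover have "\<not> (X \<in> u \<and> S - X \<in> u)"
  proof
    assume "X \<in> u \<and> S - X \<in> u"
    then have "X \<inter> (S - X) \<in> u"
      using assms(1) by (simp add: ultrafilters_over_def del: Diff_disjoint)
    moreover have "X \<inter> (S - X) = {}" by blast
    ultimately show False using assms(1) by (simp add: ultrafilters_over_def)
  qed
  ultimately show ?thesis by blast
qed

lemma ultrafilter_Int_iff:
  assumes "u \<in> ultrafilters_over S" and "X \<subseteq> S" and "Y \<subseteq> S"
  shows "X \<inter> Y \<in> u \<longleftrightarrow> X \<in> u \<and> Y \<in> u"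
proof
  have up: "B \<in> u" if "A \<in> u" "A \<subseteq> B" "B \<subseteq> S" for A B
    using assms(1) that by (simp add: ultrafilters_over_def)
  assume "X \<inter> Y \<in> u"
  then show "X \<in> u \<and> Y \<in> u"
    using assms(2,3) by (blast intro: up)
next
  assume "X \<in> u \<and> Y \<in> u"
  then show "X \<inter> Y \<in> u"
    using assms(1) by (simp add: ultrafilters_over_def)
qed

lemma hat_Diff: "X \<subseteq> S \<Longrightarrow> hat S (S - X) = ultrafilters_over S - hat S X"
  by (auto simp: hat_def ultrafilter_Diff_iff)

lemma hat_Int: "X \<subseteq> S \<Longrightarrow> Y \<subseteq> S \<Longrightarrow> hat S (X \<inter> Y) = hat S X \<inter> hat S Y"
  by (auto simp: hat_def ultrafilter_Int_iff)

text \<open>The principal ultrafilters separate subsets of \<open>S\<close>.\<close>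

lemma hat_inject:
  assumes "X \<subseteq> S" and "Y \<subseteq> S"
  shows "hat S X = hat S Y \<longleftrightarrow> X = Y"
proof
  assume eq: "hat S X = hat S Y"
  have "s \<in> X \<longleftrightarrow> s \<in> Y" if "s \<in> S" for s
  proof -
    have "{Z. Z \<subseteq> S \<and> s \<in> Z} \<in> hat S X \<longleftrightarrow> {Z. Z \<subseteq> S \<and> s \<in> Z} \<in> hat S Y"
      by (simp add: eq)
    then show ?thesis
      using assms principal_ultrafilter[OF that] by (simp add: hat_def)
  qed
  then show "X = Y" using assms by blast
qed simp

lemma hat_in_nbhds_ue_iff:
  assumes "X \<subseteq> worlds M"
  shows "hat (worlds M) X \<in> nbhds (ue M) u \<longleftrightarrow> m_C M X \<in> u"
  using assms hat_inject[OF assms] by (auto simp: ue_def)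

lemma m_C_Diff: "X \<subseteq> worlds M \<Longrightarrow> m_C M (worlds M - X) = m_C M X"
  by (auto simp: m_C_def double_diff)

lemma truth_set_subset: "truth_set M \<phi> \<subseteq> worlds M"
  by (auto simp: truth_set_def)

lemma truth_set_simps:
  "truth_set M (Neg \<phi>) = worlds M - truth_set M \<phi>"
  "truth_set M (Conj \<phi> \<psi>) = truth_set M \<phi> \<inter> truth_set M \<psi>"
  "truth_set M (Nabla \<phi>) = worlds M - m_C M (truth_set M \<phi>)"
  by (auto simp: truth_set_def m_C_def)

text \<open>On sets \<open>hat X\<close> the operation \<open>m_C\<close> of the extension is computed in \<open>M\<close>.  As \<open>m_C\<close> does not
  distinguish a set from its complement, the two disjuncts in the semantics of \<open>Delta\<close> coincide
  in \<open>ue M\<close>.\<close>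

lemma m_C_ue_hat:
  assumes "X \<subseteq> worlds M"
  shows "m_C (ue M) (hat (worlds M) X) = hat (worlds M) (m_C M X)"
proof -
  have worlds: "worlds (ue M) = ultrafilters_over (worlds M)" by (simp add: ue_def)
  have "worlds (ue M) - hat (worlds M) X \<in> nbhds (ue M) u \<longleftrightarrow> m_C M X \<in> u" for u
    using hat_in_nbhds_ue_iff[of "worlds M - X" M u]
    by (simp add: worlds m_C_Diff assms flip: hat_Diff)
  then show ?thesis
    by (auto simp: m_C_def[of "ue M"] hat_in_nbhds_ue_iff[OF assms] worlds hat_def[of _ "m_C M X"])
qed

lemma truth_set_ue:
  assumes "nbhd_model M"
  shows "truth_set (ue M) \<phi> = hat (worlds M) (truth_set M \<phi>)"
proof (induction \<phi>)
  case (Var p)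
  have "truth_set M (Var p) = val M p"
    using assms by (auto simp: nbhd_model_def truth_set_def)
  then show ?case by (auto simp: truth_set_def ue_def hat_def)
next
  case (Neg \<phi>)
  then show ?case
    by (simp add: truth_set_simps hat_Diff truth_set_subset) (simp add: ue_def)
next
  case (Conj \<phi> \<psi>)
  then show ?case
    by (simp add: truth_set_simps hat_Int truth_set_subset)
next
  case (Nabla \<phi>)
  have "m_C M (truth_set M \<phi>) \<subseteq> worlds M" by (auto simp: m_C_def)
  with Nabla show ?case
    by (simp add: truth_set_simps m_C_ue_hat hat_Diff truth_set_subset) (simp add: ue_def)
qed

lemma sat_ue_iff:
  assumes "nbhd_model M" and "u \<in> ultrafilters_over (worlds M)"
  shows "sat (ue M) u \<phi> \<longleftrightarrow> truth_set M \<phi> \<in> u"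
proof -
  have "sat (ue M) u \<phi> \<longleftrightarrow> u \<in> truth_set (ue M) \<phi>"
    using assms(2) by (simp add: truth_set_def ue_def)
  also have "\<dots> \<longleftrightarrow> truth_set M \<phi> \<in> u"
    using assms by (simp add: truth_set_ue hat_def)
  finally show ?thesis .
qed

section \<open>Saturation of the ultrafilter extension\<close>

text \<open>A point satisfying finitely many formulas of \<open>\<Gamma>\<close> in \<open>hat X\<close> is an ultrafilter that contains
  \<open>X\<close> and the corresponding truth sets, so these have a common element.\<close>

lemma delta_compact_hat:
  assumes M: "nbhd_model M" and X: "X \<subseteq> worlds M"
  shows "delta_compact (ue M) (hat (worlds M) X)"
  unfolding delta_compact_def
proof (intro allI impI)
  fix \<Gamma> :: "'b fm set"
  assume fin_sat: "finitely_satisfiable_in (ue M) (hat (worlds M) X) \<Gamma>"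
  let ?F = "insert X (truth_set M ` \<Gamma>)"
  have "fip (worlds M) ?F"
    unfolding fip_insert_iff
  proof (intro allI impI)
    fix G assume "finite G \<and> G \<subseteq> truth_set M ` \<Gamma>"
    then obtain \<Gamma>\<^sub>0 where \<Gamma>\<^sub>0: "finite \<Gamma>\<^sub>0" "\<Gamma>\<^sub>0 \<subseteq> \<Gamma>" "G = truth_set M ` \<Gamma>\<^sub>0"
      using finite_subset_image by metis
    then obtain u where u: "u \<in> hat (worlds M) X" "\<forall>\<phi>\<in>\<Gamma>\<^sub>0. sat (ue M) u \<phi>"
      using fin_sat unfolding finitely_satisfiable_in_def satisfiable_in_def by blast
    then have "u \<in> ultrafilters_over (worlds M)" "X \<in> u" by (auto simp: hat_def)
    moreover from this have "G \<subseteq> u"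
      using u \<Gamma>\<^sub>0 sat_ue_iff[OF M] by auto
    ultimately have "worlds M \<inter> \<Inter>(insert X G) \<noteq> {}"
      using \<Gamma>\<^sub>0 by (intro fipD[OF ultrafilter_fip]) auto
    then show "worlds M \<inter> \<Inter>G \<inter> X \<noteq> {}" by auto
  qed
  moreover have "?F \<subseteq> Pow (worlds M)"
    using X truth_set_subset[of M] by auto
  ultimately obtain u where "u \<in> ultrafilters_over (worlds M)" "?F \<subseteq> u"
    by (metis ultrafilter_extending_fip)
  then have "u \<in> hat (worlds M) X" "\<forall>\<phi>\<in>\<Gamma>. sat (ue M) u \<phi>"
    using sat_ue_iff[OF M] by (auto simp: hat_def)
  then show "satisfiable_in (ue M) (hat (worlds M) X) \<Gamma>"
    unfolding satisfiable_in_def by blast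
qed

theorem proposition32:
  fixes M :: "('w, 'p) nbhd_structure"
  assumes "nbhd_model M"
  shows "delta_saturated (ue M)"
  unfolding delta_saturated_def
proof (intro ballI impI)
  fix u \<X> assume "\<X> \<in> nbhds (ue M) u"
  then obtain X where X: "X \<subseteq> worlds M" and \<X>: "\<X> = hat (worlds M) X"
    by (auto simp: ue_def)
  have "worlds (ue M) - \<X> = hat (worlds M) (worlds M - X)"
    using X by (simp add: \<X> hat_Diff) (simp add: ue_def)
  then show "delta_compact (ue M) \<X> \<and> delta_compact (ue M) (worlds (ue M) - \<X>)"
    using delta_compact_hat[OF assms] X by (simp add: \<X>)
qed

end
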